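(* Let $p$ be a non-zero element of $\mathbb{C}^n$. Then the set $$\mathcal{E}(p)=\{\phi_a:\mathbf{U}(n)\to\mathbb{C}\mid \phi_a(z)=\operatorname{trace}(p^t a z^t),\ a\in\mathbb{C}^n\}$$ of complex valued functions is an eigenfamily on $\mathbf{U}(n)$.
   Context: $\mathbf{U}(n)=\{z\in\mathbf{GL}_n(\mathbb{C})\mid z z^*=I_n\}$ carries the left-invariant Riemannian metric induced by the scalar product $g(Z,W)=\operatorname{Re}\operatorname{trace}(ZW^* )$ on its Lie algebra $\mathfrak{u}(n)$ of skew-Hermitian $n\times n$ matrices. Elements of $\mathbb{C}^n$ are row vectors, so $p^t a$ is an $n\times n$ complex matrix; $t$ denotes transpose without conjugation. For complex valued functions $\phi,\psi$ on a semi-Riemannian manifold $(M,g)$, $\tau(\phi)$ is the Laplacian ($\operatorname{div}\operatorname{grad}$) extended complex linearly and $\kappa(\phi,\psi)=g(\operatorname{grad}(\phi),\operatorname{grad}(\psi))$ with $g$ extended complex bilinearly. On $\mathbf{U}(n)$ these are $\tau(\phi)=\sum_{Z\in\mathcal{B}}Z^2(\phi)$ and $\kappa(\phi,\psi)=\sum_{Z\in\mathcal{B}}Z(\phi)Z(\psi)$ for any orthonormal basis $\mathcal{B}$ of the Lie algebra of left-invariant vector fields. A set $\mathcal{E}$ of complex valued functions on $M$ is an eigenfamily if there exist $\lambda,\mu\in\mathbb{C}$ such that $\tau(\phi)=\lambda\phi$ and $\kappa(\phi,\psi)=\mu\,\phi\psi$ for all $\phi,\psi\in\mathcal{E}$.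 *)

theory Defs
  imports "HOL-Analysis.Analysis"
begin

text \<open>Matrices over an index type \<open>'n\<close> stand for \<open>n \<times> n\<close> matrices with
  \<open>n = CARD('n)\<close>; the product is \<open>**\<close>.\<close>

definition conj_transpose :: "complex^'n^'n \<Rightarrow> complex^'n^'n"
  where "conj_transpose A = (\<chi> i j. cnj (A $ j $ i))"

definition unitary_group :: "(complex^'n^'n) set"
  where "unitary_group = {z. invertible z \<and> z ** conj_transpose z = mat 1}"

definition unitary_algebra :: "(complex^'n^'n) set"
  where "unitary_algebra = {Z. conj_transpose Z = - Z}"

definition metric_u :: "complex^'n^'n \<Rightarrow> complex^'n^'n \<Rightarrow> real"
  where "metric_u Z W = Re (trace (Z ** conj_transpose W))"

text \<open>Here \<open>span\<close> is the real span.\<close>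

definition orthonormal_basis_u :: "(complex^'n^'n) set \<Rightarrow> bool"
  where "orthonormal_basis_u B \<longleftrightarrow>
    B \<subseteq> unitary_algebra \<and> span B = unitary_algebra \<and>
    (\<forall>Z\<in>B. \<forall>W\<in>B. metric_u Z W = (if Z = W then 1 else 0))"

text \<open>The function \<open>exp\<close> of the library needs a normed algebra, which the type of square
  matrices is not an instance of, so the exponential series is written out.\<close>

definition matrix_exp :: "complex^'n^'n \<Rightarrow> complex^'n^'n"
  where "matrix_exp A = (\<Sum>k. (1 / fact k) *\<^sub>R ((**) A ^^ k) (mat 1))"

text \<open>Functions on the group are represented extensionally: they take the value
  \<open>undefined\<close> outside of it. The left-invariant vector field of \<open>Z\<close> has the flow
  \<open>z \<mapsto> z exp(sZ)\<close>, which stays in the group when \<open>Z\<close> is skew-Hermitian.\<close>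

definition left_inv_field ::
    "complex^'n^'n \<Rightarrow> (complex^'n^'n \<Rightarrow> complex) \<Rightarrow> complex^'n^'n \<Rightarrow> complex"
  where "left_inv_field Z \<phi> =
    (\<lambda>z\<in>unitary_group. vector_derivative (\<lambda>s. \<phi> (z ** matrix_exp (s *\<^sub>R Z))) (at 0))"

text \<open>Smoothness: the left-invariant fields form a global frame, so a function is smooth iff
  all its iterated derivatives along them exist and are continuous on the group.
  The definition is coinductive in order to cover all orders.\<close>

coinductive smooth_on_unitary :: "(complex^'n^'n \<Rightarrow> complex) \<Rightarrow> bool"
  where "\<lbrakk>\<phi> \<in> extensional unitary_group; continuous_on unitary_group \<phi>;
    \<forall>Z\<in>unitary_algebra. \<forall>z\<in>unitary_group.
      (\<lambda>s. \<phi> (z ** matrix_exp (s *\<^sub>R Z))) differentiable (at 0);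
    \<forall>Z\<in>unitary_algebra. smooth_on_unitary (left_inv_field Z \<phi>)\<rbrakk>
    \<Longrightarrow> smooth_on_unitary \<phi>"

text \<open>The Laplacian and the conformality operator, computed in an orthonormal basis \<open>B\<close>
  of the Lie algebra. On smooth functions they do not depend on \<open>B\<close>.\<close>

definition tau ::
    "(complex^'n^'n) set \<Rightarrow> (complex^'n^'n \<Rightarrow> complex) \<Rightarrow> complex^'n^'n \<Rightarrow> complex"
  where "tau B \<phi> z = (\<Sum>Z\<in>B. left_inv_field Z (left_inv_field Z \<phi>) z)"

definition kappa :: "(complex^'n^'n) set \<Rightarrow> (complex^'n^'n \<Rightarrow> complex) \<Rightarrow>
    (complex^'n^'n \<Rightarrow> complex) \<Rightarrow> complex^'n^'n \<Rightarrow> complex"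
  where "kappa B \<phi> \<psi> z = (\<Sum>Z\<in>B. left_inv_field Z \<phi> z * left_inv_field Z \<psi> z)"

text \<open>The eigenvalues \<open>l\<close>, \<open>m\<close> are chosen before the orthonormal basis, so they are the same
  for every basis; \<open>ex_orthonormal_basis_u\<close> below shows that the condition is not vacuous.\<close>

definition eigenfamily :: "(complex^'n^'n \<Rightarrow> complex) set \<Rightarrow> bool"
  where "eigenfamily E \<longleftrightarrow>
    (\<forall>\<phi>\<in>E. smooth_on_unitary \<phi>) \<and>
    (\<exists>l m. \<forall>B. orthonormal_basis_u B \<longrightarrow>
      (\<forall>\<phi>\<in>E. \<forall>\<psi>\<in>E. \<forall>z\<in>unitary_group.
        tau B \<phi> z = l * \<phi> z \<and> kappa B \<phi> \<psi> z = m * \<phi> z * \<psi> z))"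

lemma metric_u_eq_inner: "metric_u Z W = Z \<bullet> W"
  by (simp add: metric_u_def trace_def matrix_matrix_mult_def conj_transpose_def
      inner_vec_def inner_complex_def)

lemma subspace_unitary_algebra: "subspace unitary_algebra"
  by (auto simp: subspace_def unitary_algebra_def conj_transpose_def vec_eq_iff)

lemma finite_orthonormal_basis_u:
  assumes "orthonormal_basis_u B" shows "finite B"
proof -
  have B: "Z \<bullet> W = (if Z = W then 1 else 0)" if "Z \<in> B" "W \<in> B" for Z W
    using assms that by (simp add: orthonormal_basis_u_def metric_u_eq_inner)
  have "pairwise orthogonal B" and "0 \<notin> B"
    using B by (auto simp: pairwise_def orthogonal_def) (metis inner_zero_left zero_neq_one)
  then show ?thesis
    using pairwise_orthogonal_independent independent_bound by blast
qed

lemma ex_orthonormal_basis_u: "\<exists>B :: (complex^'n^'n) set. orthonormal_basis_u B"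
proof -
  obtain B :: "(complex^'n^'n) set" where "B \<subseteq> unitary_algebra" "pairwise orthogonal B"
      "\<And>x. x \<in> B \<Longrightarrow> norm x = 1" "span B = unitary_algebra"
    using orthonormal_basis_subspace[OF subspace_unitary_algebra] by metis
  then have "orthonormal_basis_u B"
    by (auto simp: orthonormal_basis_u_def metric_u_eq_inner pairwise_def orthogonal_def
        simp flip: power2_norm_eq_inner)
  then show ?thesis ..
qed

end

theory Submission
  imports Defs
begin

text \<open>Writing \<open>w = pz\<close>, we have \<open>\<phi>\<^sub>a(z) = \<Sum>\<^sub>j w\<^sub>j a\<^sub>j\<close>, the restriction of a linear function of \<open>z\<close>; a
  left-invariant field \<open>Z\<close> sends the restriction of a linear \<open>f\<close> to that of \<open>z \<mapsto> f (zZ)\<close>, which is again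
  linear, whence smoothness. For every orthonormal basis of the Lie algebra,
  \<open>\<Sum>\<^sub>Z Z\<^sub>i\<^sub>j Z\<^sub>k\<^sub>l = - \<delta>\<^sub>j\<^sub>k \<delta>\<^sub>i\<^sub>l\<close>. Contracting gives \<open>\<Sum>\<^sub>Z Z\<^sup>2 = - n I\<close> and
  \<open>\<Sum>\<^sub>Z Z(\<phi>\<^sub>a) Z(\<phi>\<^sub>b) = - \<phi>\<^sub>a \<phi>\<^sub>b\<close>, so the eigenvalues are \<open>\<lambda> = - n\<close> and \<open>\<mu> = - 1\<close>.\<close>

section \<open>Matrix product, conjugate transpose and entrywise derivatives\<close>

lemma bounded_bilinear_matrix_mult:
  "bounded_bilinear ((**) :: complex^'m^'n \<Rightarrow> complex^'k^'m \<Rightarrow> complex^'k^'n)"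
  unfolding bilinear_conv_bounded_bilinear[symmetric] bilinear_def
  by (auto intro!: linearI simp: matrix_matrix_mult_def vec_eq_iff algebra_simps
      sum.distrib scaleR_sum_right)

lemma bounded_linear_conj_transpose: "bounded_linear conj_transpose"
  unfolding linear_conv_bounded_linear[symmetric]
  by (auto intro!: linearI simp: conj_transpose_def vec_eq_iff)

lemma conj_transpose_mult: "conj_transpose (A ** B) = conj_transpose B ** conj_transpose A"
  by (simp add: conj_transpose_def matrix_matrix_mult_def vec_eq_iff mult.commute)

lemma conj_transpose_mat_1: "conj_transpose (mat 1) = mat 1"
  by (simp add: conj_transpose_def mat_def vec_eq_iff)

text \<open>Every basis vector has the form \<open>axis i u\<close>. Used twice in a row, for rows
  and then for entries, this reduces the derivative of a matrix curve to complex-valued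
  functions.\<close>

lemma has_vector_derivative_vecI:
  fixes f :: "real \<Rightarrow> 'a::euclidean_space^'n"
  assumes "\<And>i. ((\<lambda>s. f s $ i) has_vector_derivative D $ i) (at t within S)"
  shows "(f has_vector_derivative D) (at t within S)"
  unfolding has_vector_derivative_def
proof (subst has_derivative_componentwise_within, intro ballI)
  fix b :: "'a^'n" assume "b \<in> Basis"
  then obtain i u where b: "b = axis i u" by (auto simp: Basis_vec_def)
  have "((\<lambda>s. f s $ i \<bullet> u) has_derivative (\<lambda>h. (h *\<^sub>R D $ i) \<bullet> u)) (at t within S)"
    using assms[of i] unfolding has_vector_derivative_def by (rule has_derivative_inner_left)
  then show "((\<lambda>s. f s \<bullet> b) has_derivative (\<lambda>h. (h *\<^sub>R D) \<bullet> b)) (at t within S)"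
    by (simp add: b inner_axis)
qed

section \<open>The matrix exponential\<close>

text \<open>The powers are built by multiplying on the left, whereas the flow of a left-invariant
  field needs the factor on the right.\<close>

lemma matrix_power_commute: "((**) A ^^ k) (mat 1) ** A = A ** ((**) A ^^ k) (mat 1)"
  by (induction k) (simp_all flip: matrix_mul_assoc)

lemma matrix_power_scaleR:
  fixes A :: "complex^'n^'n"
  shows "((**) (s *\<^sub>R A) ^^ k) (mat 1) = s ^ k *\<^sub>R ((**) A ^^ k) (mat 1)"
  by (induction k) (simp_all add: matrix_scalar_ac scalar_matrix_assoc[symmetric])

lemma norm_matrix_power_le:
  fixes A :: "complex^'n^'n"
  obtains r where "\<And>k. norm (((**) A ^^ k) (mat 1)) \<le> norm (mat 1 :: complex^'n^'n) * r ^ k"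
proof -
  \<comment> \<open>The Euclidean norm enters only through boundedness of the product, so
    submultiplicativity is used up to a constant \<open>K\<close>, and \<open>r\<close> is
    \<open>norm A * K\<close>.\<close>
  obtain K where K: "K > 0"
      "\<And>(A :: complex^'n^'n) (B :: complex^'n^'n). norm (A ** B) \<le> norm A * norm B * K"
    using bounded_bilinear.pos_bounded[OF bounded_bilinear_matrix_mult] by metis
  have "norm (((**) A ^^ k) (mat 1)) \<le> norm (mat 1 :: complex^'n^'n) * (norm A * K) ^ k" for k
  proof (induction k)
    case (Suc k)
    have "norm (((**) A ^^ Suc k) (mat 1)) \<le> (norm A * K) * norm (((**) A ^^ k) (mat 1))"
      using K(2)[of A "((**) A ^^ k) (mat 1)"] by (simp add: algebra_simps)
    also have "\<dots> \<le> (norm A * K) * (norm (mat 1 :: complex^'n^'n) * (norm A * K) ^ k)"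
      using Suc K(1) by (intro mult_left_mono) auto
    finally show ?case by (simp add: algebra_simps)
  qed simp
  then show thesis by (rule that)
qed

lemma summable_matrix_exp:
  fixes A :: "complex^'n^'n"
  shows "summable (\<lambda>k. (1 / fact k) *\<^sub>R ((**) A ^^ k) (mat 1))"
proof -
  obtain r where r: "\<And>k. norm (((**) A ^^ k) (mat 1)) \<le> norm (mat 1 :: complex^'n^'n) * r ^ k"
    using norm_matrix_power_le[of A] by blast
  have "summable (\<lambda>k. norm (mat 1 :: complex^'n^'n) * (inverse (fact k) * r ^ k))"
    by (intro summable_mult summable_exp)
  then show ?thesis
    by (rule summable_comparison_test[rotated])
      (use r in \<open>auto simp: divide_simps mult.commute\<close>)
qed

lemma matrix_exp_nth:
  fixes A :: "complex^'n^'n"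
  shows "(\<lambda>k. ((**) A ^^ k) (mat 1) $ i $ j / fact k) sums (matrix_exp A $ i $ j)"
proof -
  have bl: "bounded_linear (\<lambda>A :: complex^'n^'n. A $ i $ j)"
    by (intro bounded_linear_compose[OF bounded_linear_vec_nth] bounded_linear_vec_nth)
  have "(\<lambda>k. ((1 / fact k) *\<^sub>R ((**) A ^^ k) (mat 1)) $ i $ j) sums (matrix_exp A $ i $ j)"
    unfolding matrix_exp_def
    by (rule bounded_linear.sums[OF bl summable_sums[OF summable_matrix_exp]])
  then show ?thesis by (simp add: scaleR_conv_of_real[where 'a=complex])
qed

lemma matrix_exp_0: "matrix_exp (0 :: complex^'n^'n) = mat 1"
proof -
  have "((**) (0 :: complex^'n^'n) ^^ k) (mat 1) = (if k = 0 then mat 1 else 0)" for k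
    by (cases k) auto
  then have "(\<lambda>k. (1 / fact k) *\<^sub>R ((**) (0 :: complex^'n^'n) ^^ k) (mat 1)) =
      (\<lambda>k. if k = 0 then mat 1 else 0)"
    by auto
  then show ?thesis
    unfolding matrix_exp_def using sums_single[of 0 "\<lambda>_. mat 1 :: complex^'n^'n"]
    by (simp add: sums_iff)
qed

text \<open>Each entry is an everywhere convergent complex power series evaluated at a real
  parameter, so it may be differentiated term by term.\<close>

lemma has_vector_derivative_matrix_exp:
  fixes A :: "complex^'n^'n"
  shows "((\<lambda>s. matrix_exp (s *\<^sub>R A)) has_vector_derivative matrix_exp (t *\<^sub>R A) ** A) (at t)"
proof (intro has_vector_derivative_vecI)
  fix i j
  define c where "c = (\<lambda>k. ((**) A ^^ k) (mat 1) $ i $ j / fact k)"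
  have power_sums: "(\<lambda>k. ((**) A ^^ k) (mat 1) $ i' $ j' / fact k * of_real s ^ k)
      sums (matrix_exp (s *\<^sub>R A) $ i' $ j')" for s i' j'
    using matrix_exp_nth[of "s *\<^sub>R A" i' j']
    by (simp add: matrix_power_scaleR scaleR_conv_of_real[where 'a=complex] mult.commute)
  \<comment> \<open>Convergence is known at real points only; the real point
    \<open>norm y + 1\<close> lies strictly outside the radius of the complex number
    \<open>y\<close>.\<close>
  have "summable (\<lambda>k. c k * y ^ k)" for y
  proof (rule powser_inside)
    show "summable (\<lambda>k. c k * of_real (norm y + 1) ^ k)"
      using power_sums[of i j "norm y + 1"] by (simp add: c_def sums_iff)
    show "norm y < norm (complex_of_real (norm y + 1))"
      by (simp del: of_real_add)
  qed
  then have "((\<lambda>w. \<Sum>k. c k * w ^ k) has_field_derivative (\<Sum>k. diffs c k * of_real t ^ k))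
      (at (complex_of_real t))"
    by (rule termdiffs_strong_converges_everywhere)
  then have "((\<lambda>s. \<Sum>k. c k * of_real s ^ k) has_vector_derivative
      (\<Sum>k. diffs c k * of_real t ^ k)) (at t)"
    by (rule has_vector_derivative_real_field)
  moreover have "(\<Sum>k. c k * of_real s ^ k) = matrix_exp (s *\<^sub>R A) $ i $ j" for s
    using power_sums[of i j s] by (simp add: c_def sums_iff)
  moreover have "(\<lambda>k. diffs c k * of_real t ^ k) sums (matrix_exp (t *\<^sub>R A) ** A) $ i $ j"
  proof -
    have "(\<lambda>k. \<Sum>l\<in>UNIV. ((**) A ^^ k) (mat 1) $ i $ l / fact k * of_real t ^ k * A $ l $ j)
        sums (\<Sum>l\<in>UNIV. matrix_exp (t *\<^sub>R A) $ i $ l * A $ l $ j)"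
      by (intro sums_sum sums_mult2 power_sums)
    moreover have "diffs c k * of_real t ^ k =
        (\<Sum>l\<in>UNIV. ((**) A ^^ k) (mat 1) $ i $ l / fact k * of_real t ^ k * A $ l $ j)" for k
    proof -
      \<comment> \<open>The factor \<open>Suc k\<close> from differentiation cancels against
        \<open>fact (Suc k)\<close>, leaving the next power of \<open>A\<close> over
        \<open>fact k\<close>.\<close>
      have "diffs c k = (((**) A ^^ k) (mat 1) ** A) $ i $ j / fact k"
        by (simp add: diffs_def c_def matrix_power_commute del: of_nat_Suc)
      also have "\<dots> = (\<Sum>l\<in>UNIV. ((**) A ^^ k) (mat 1) $ i $ l * A $ l $ j) / fact k"
        by (simp add: matrix_matrix_mult_def)
      finally show ?thesis
        by (simp add: sum_divide_distrib sum_distrib_left mult_ac)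
    qed
    ultimately show ?thesis
      by (simp add: matrix_matrix_mult_def)
  qed
  ultimately show "((\<lambda>s. matrix_exp (s *\<^sub>R A) $ i $ j) has_vector_derivative
      (matrix_exp (t *\<^sub>R A) ** A) $ i $ j) (at t)"
    by (simp add: sums_iff)
qed

text \<open>Since \<open>Z* = -Z\<close>, the derivative of \<open>exp(sZ) exp(sZ)*\<close> vanishes.\<close>

lemma matrix_exp_mult_conj_transpose:
  fixes Z :: "complex^'n^'n"
  assumes "Z \<in> unitary_algebra"
  shows "matrix_exp (s *\<^sub>R Z) ** conj_transpose (matrix_exp (s *\<^sub>R Z)) = mat 1"
proof -
  let ?G = "\<lambda>s. matrix_exp (s *\<^sub>R Z)"
  let ?F = "\<lambda>s. ?G s ** conj_transpose (?G s)"
  have neg: "A ** (- Z) ** B = - (A ** Z ** B)" for A B :: "complex^'n^'n"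
    by (simp add: matrix_matrix_mult_def vec_eq_iff sum_negf)
  have "(?F has_vector_derivative 0) (at t within UNIV)" for t
  proof -
    have "((\<lambda>s. conj_transpose (?G s)) has_vector_derivative
        conj_transpose (?G t ** Z)) (at t)"
      by (rule bounded_linear.has_vector_derivative[OF bounded_linear_conj_transpose
          has_vector_derivative_matrix_exp])
    from bounded_bilinear.has_vector_derivative[OF bounded_bilinear_matrix_mult
        has_vector_derivative_matrix_exp this]
    have "(?F has_vector_derivative ?G t ** conj_transpose (?G t ** Z) +
        ?G t ** Z ** conj_transpose (?G t)) (at t)" .
    then show ?thesis
      using assms by (simp add: conj_transpose_mult unitary_algebra_def matrix_mul_assoc neg)
  qed
  then obtain c where "\<And>s. ?F s = c"
    using has_vector_derivative_zero_constant[of UNIV ?F] by auto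
  moreover have "?F 0 = mat 1"
    by (simp add: matrix_exp_0 conj_transpose_mat_1)
  ultimately show ?thesis by metis
qed

text \<open>Along such a curve a restricted function agrees with the original one, so the value
  \<open>undefined\<close> never enters a derivative.\<close>

lemma mult_matrix_exp_in_unitary_group:
  assumes "z \<in> unitary_group" "Z \<in> unitary_algebra"
  shows "z ** matrix_exp (s *\<^sub>R Z) \<in> unitary_group"
proof -
  let ?e = "matrix_exp (s *\<^sub>R Z)"
  have e: "?e ** conj_transpose ?e = mat 1"
    by (rule matrix_exp_mult_conj_transpose[OF assms(2)])
  have "z ** ?e ** conj_transpose (z ** ?e) = z ** (?e ** conj_transpose ?e) ** conj_transpose z"
    by (simp add: conj_transpose_mult matrix_mul_assoc)
  also have "\<dots> = mat 1"
    using assms(1) e by (simp add: unitary_group_def)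
  moreover have "invertible ?e"
    using e invertible_right_inverse by blast
  ultimately show ?thesis
    using assms(1) by (simp add: unitary_group_def invertible_mult)
qed

section \<open>Restrictions of linear functions to the unitary group\<close>

lemma has_vector_derivative_linear_matrix_exp:
  fixes f :: "complex^'n^'n \<Rightarrow> complex"
  assumes "linear f" "z \<in> unitary_group" "Z \<in> unitary_algebra"
  shows "((\<lambda>s. restrict f unitary_group (z ** matrix_exp (s *\<^sub>R Z)))
    has_vector_derivative f (z ** Z)) (at 0)"
proof -
  have "bounded_linear (\<lambda>A. f (z ** A))"
    using assms(1) bounded_linear_compose[OF _
        bounded_bilinear.bounded_linear_right[OF bounded_bilinear_matrix_mult]]
    by (simp add: linear_conv_bounded_linear)
  from bounded_linear.has_vector_derivative[OF this has_vector_derivative_matrix_exp[of Z 0]]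
  show ?thesis
    using assms(2,3) by (simp add: matrix_exp_0 mult_matrix_exp_in_unitary_group)
qed

text \<open>The result is again the restriction of a real linear function, so the rule can be
  iterated.\<close>

lemma left_inv_field_linear:
  fixes f :: "complex^'n^'n \<Rightarrow> complex"
  assumes "linear f" "Z \<in> unitary_algebra"
  shows "left_inv_field Z (restrict f unitary_group) = (\<lambda>z\<in>unitary_group. f (z ** Z))"
  unfolding left_inv_field_def
  using vector_derivative_at[OF has_vector_derivative_linear_matrix_exp[OF assms(1) _ assms(2)]]
  by (auto intro!: restrict_ext)

lemma linear_mult_right:
  fixes f :: "complex^'n^'n \<Rightarrow> complex"
  assumes "linear f" shows "linear (\<lambda>z. f (z ** Z))"
  using linear_compose[OF bounded_linear.linear[OF
      bounded_bilinear.bounded_linear_left[OF bounded_bilinear_matrix_mult]] assms]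
  by (simp add: o_def)

lemma smooth_on_unitary_linear:
  fixes f :: "complex^'n^'n \<Rightarrow> complex"
  assumes "linear f"
  shows "smooth_on_unitary (restrict f unitary_group)"
proof -
  define \<phi> where "\<phi> = restrict f unitary_group"
  \<comment> \<open>The coinduction invariant: \<open>f\<close> is quantified existentially because
    each derivative replaces it by another linear function.\<close>
  have "\<exists>f. linear f \<and> \<phi> = restrict f unitary_group"
    using assms by (auto simp: \<phi>_def)
  then have "smooth_on_unitary \<phi>"
  proof (coinduction arbitrary: \<phi>)
    case smooth_on_unitary
    then obtain f where f: "linear f" and \<phi>: "\<phi> = restrict f unitary_group" by blast
    have "continuous_on unitary_group f"
      using f by (simp add: linear_continuous_on linear_conv_bounded_linear)
    then have cont: "continuous_on unitary_group \<phi>"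
      unfolding \<phi> by (rule continuous_on_eq) simp
    have diff: "(\<lambda>s. \<phi> (z ** matrix_exp (s *\<^sub>R Z))) differentiable (at 0)"
      if "Z \<in> unitary_algebra" "z \<in> unitary_group" for Z z
      using has_vector_derivative_linear_matrix_exp[OF f that(2,1)]
      unfolding \<phi> by (rule differentiableI_vector)
    have field: "\<exists>g. linear g \<and> left_inv_field Z \<phi> = restrict g unitary_group"
      if "Z \<in> unitary_algebra" for Z
      using left_inv_field_linear[OF f that] linear_mult_right[OF f] unfolding \<phi> by blast
    show ?case
    proof (intro exI[of _ \<phi>] conjI ballI refl)
      show "\<phi> \<in> extensional unitary_group" by (simp add: \<phi>)
    qed (use cont diff field in simp_all)
  qed
  then show ?thesis by (simp add: \<phi>_def)
qed

section \<open>Contraction over an orthonormal basis\<close>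

text \<open>This is the orthonormal expansion of \<open>X\<close>, with the inner product rewritten
  as minus a trace. The form without conjugation or real part is the one that extends complex
  linearly.\<close>

lemma sum_orthonormal_basis_u_skew:
  fixes X :: "complex^'n^'n"
  assumes B: "orthonormal_basis_u B" and X: "X \<in> unitary_algebra"
  shows "(\<Sum>Z\<in>B. trace (X ** Z) * Z $ k $ l) = - X $ k $ l"
proof -
  have on: "Z \<bullet> W = (if Z = W then 1 else 0)" if "Z \<in> B" "W \<in> B" for Z W
    using B that by (simp add: orthonormal_basis_u_def metric_u_eq_inner)
  have "(\<Sum>Z\<in>B. (X \<bullet> Z) *\<^sub>R Z) = X"
  proof (rule orthonormal_basis_expand)
    show "pairwise orthogonal B" using on by (auto simp: pairwise_def orthogonal_def)
    show "norm Z = 1" if "Z \<in> B" for Z using on[OF that that] by (simp add: norm_eq_1)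
    show "X \<in> span B" using B X by (simp add: orthonormal_basis_u_def)
    show "finite B" using B by (rule finite_orthonormal_basis_u)
  qed
  then have "X $ k $ l = (\<Sum>Z\<in>B. (X \<bullet> Z) *\<^sub>R Z) $ k $ l" by simp
  also have "\<dots> = (\<Sum>Z\<in>B. of_real (X \<bullet> Z) * Z $ k $ l)"
    by (simp add: scaleR_conv_of_real[where 'a=complex])
  also have "\<dots> = (\<Sum>Z\<in>B. - trace (X ** Z) * Z $ k $ l)"
  proof (intro sum.cong refl)
    fix Z assume "Z \<in> B"
    then have Z: "conj_transpose Z = - Z"
      using B by (auto simp: orthonormal_basis_u_def unitary_algebra_def)
    have cX: "conj_transpose X = - X" using X by (simp add: unitary_algebra_def)
    \<comment> \<open>The two signs from skew-Hermitian factors cancel, and cyclicity of the trace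
      shows that the trace is real.\<close>
    have "cnj (trace (X ** Z)) = trace (conj_transpose (X ** Z))"
      by (simp add: trace_def conj_transpose_def)
    also have "\<dots> = trace (Z ** X)"
      unfolding conj_transpose_mult Z cX by (simp add: trace_def matrix_matrix_mult_def)
    finally have "trace (X ** Z) \<in> \<real>"
      by (simp add: trace_mul_sym[of Z X] Reals_cnj_iff)
    then have "of_real (Re (trace (X ** Z))) = trace (X ** Z)" by simp
    moreover have "X \<bullet> Z = - Re (trace (X ** Z))"
      unfolding metric_u_eq_inner[symmetric] metric_u_def Z
      by (simp add: trace_def matrix_matrix_mult_def sum_negf)
    ultimately show "of_real (X \<bullet> Z) * Z $ k $ l = - trace (X ** Z) * Z $ k $ l" by simp
  qed
  finally show ?thesis by (simp add: sum_negf)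
qed

text \<open>Both sides are complex linear in \<open>M\<close>, and every complex matrix is a complex combination
  of two skew-Hermitian ones.\<close>

lemma sum_orthonormal_basis_u:
  fixes M :: "complex^'n^'n"
  assumes B: "orthonormal_basis_u B"
  shows "(\<Sum>Z\<in>B. trace (M ** Z) * Z $ k $ l) = - M $ k $ l"
proof -
  define X Y :: "complex^'n^'n"
    where "X = (\<chi> i j. (M $ i $ j - cnj (M $ j $ i)) / 2)"
      and "Y = (\<chi> i j. (M $ i $ j + cnj (M $ j $ i)) / (2 * \<i>))"
  have XY: "X \<in> unitary_algebra" "Y \<in> unitary_algebra"
    by (auto simp: X_def Y_def unitary_algebra_def conj_transpose_def vec_eq_iff field_simps)
  have M: "M $ i $ j = X $ i $ j + \<i> * Y $ i $ j" for i j
    by (simp add: X_def Y_def field_simps)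
  have "trace (M ** Z) = trace (X ** Z) + \<i> * trace (Y ** Z)" for Z
    by (simp add: trace_def matrix_matrix_mult_def M algebra_simps sum.distrib sum_distrib_left)
  then have "(\<Sum>Z\<in>B. trace (M ** Z) * Z $ k $ l) =
      (\<Sum>Z\<in>B. trace (X ** Z) * Z $ k $ l) + \<i> * (\<Sum>Z\<in>B. trace (Y ** Z) * Z $ k $ l)"
    by (simp add: algebra_simps sum.distrib sum_distrib_left)
  then show ?thesis
    using sum_orthonormal_basis_u_skew[OF B] XY by (simp add: M)
qed

lemma sum_orthonormal_basis_u_entries:
  fixes B :: "(complex^'n^'n) set"
  assumes "orthonormal_basis_u B"
  shows "(\<Sum>Z\<in>B. Z $ i $ j * Z $ k $ l) = (if j = k \<and> i = l then - 1 else 0)"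
proof -
  \<comment> \<open>The matrix unit at position \<open>(j, i)\<close>, with indices swapped so that
    the trace picks out \<open>Z $ i $ j\<close>.\<close>
  let ?E = "(\<chi> a b. if a = j \<and> b = i then 1 else 0) :: complex^'n^'n"
  have "trace (?E ** Z) = Z $ i $ j" for Z
  proof -
    have "trace (?E ** Z) = (\<Sum>a\<in>UNIV. \<Sum>b\<in>UNIV. if b = i then (if a = j then Z $ i $ j else 0) else 0)"
      unfolding trace_def matrix_matrix_mult_def vec_lambda_beta
      by (intro sum.cong refl) auto
    then show ?thesis by simp
  qed
  then show ?thesis
    using sum_orthonormal_basis_u[OF assms, of ?E k l] by simp
qed

text \<open>Set the two inner indices equal in the entry identity and sum over them: each of the
  \<open>CARD('n)\<close> values contributes -1 on the diagonal and 0 elsewhere.\<close>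

lemma sum_orthonormal_basis_u_squares:
  fixes B :: "(complex^'n^'n) set"
  assumes "orthonormal_basis_u B"
  shows "(\<Sum>Z\<in>B. Z ** Z) = - of_nat CARD('n) *\<^sub>R mat 1"
proof -
  have "(\<Sum>Z\<in>B. Z ** Z) $ i $ l = (- of_nat CARD('n) *\<^sub>R mat 1) $ i $ l" for i l
  proof -
    have "(\<Sum>Z\<in>B. Z ** Z) $ i $ l = (\<Sum>j\<in>UNIV. \<Sum>Z\<in>B. Z $ i $ j * Z $ j $ l)"
      by (simp add: matrix_matrix_mult_def) (rule sum.swap)
    then show ?thesis
      by (simp add: sum_orthonormal_basis_u_entries[OF assms] mat_def scaleR_conv_of_real[where 'a=complex])
  qed
  then show ?thesis by (simp add: vec_eq_iff)
qed

section \<open>The eigenfamily\<close>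

text \<open>Applying a field twice multiplies the argument on the right by \<open>Z ** Z\<close>,
  and linearity moves the sum over the basis inside \<open>f\<close>.\<close>

lemma tau_linear:
  fixes f :: "complex^'n^'n \<Rightarrow> complex"
  assumes f: "linear f" and B: "orthonormal_basis_u B" and z: "z \<in> unitary_group"
  shows "tau B (restrict f unitary_group) z = - of_nat CARD('n) * f z"
proof -
  have "tau B (restrict f unitary_group) z = (\<Sum>Z\<in>B. f (z ** (Z ** Z)))"
    unfolding tau_def
  proof (intro sum.cong refl)
    fix Z assume "Z \<in> B"
    then have Z: "Z \<in> unitary_algebra" using B by (auto simp: orthonormal_basis_u_def)
    show "left_inv_field Z (left_inv_field Z (restrict f unitary_group)) z = f (z ** (Z ** Z))"
      using left_inv_field_linear[OF f Z] left_inv_field_linear[OF linear_mult_right[OF f] Z] z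
      by (simp add: matrix_mul_assoc)
  qed
  also have "\<dots> = f (z ** (\<Sum>Z\<in>B. Z ** Z))"
    by (simp add: linear_sum[OF f] bounded_bilinear.sum_right[OF bounded_bilinear_matrix_mult])
  also have "\<dots> = f (- of_nat CARD('n) *\<^sub>R z)"
    by (simp only: sum_orthonormal_basis_u_squares[OF B] matrix_scalar_ac matrix_mul_rid)
  also have "\<dots> = - of_nat CARD('n) * f z"
    by (simp only: linear_scale[OF f]) (simp add: scaleR_conv_of_real[where 'a=complex])
  finally show ?thesis .
qed

text \<open>This exhibits dependence on \<open>z\<close> through \<open>p v* z\<close> alone, which
  turns right multiplication of \<open>z\<close> into an action on a row vector.\<close>

lemma trace_rowvectors:
  fixes p a :: "complex^'n"
  shows "trace (transpose (rowvector p :: complex^'n^1) ** (rowvector a :: complex^'n^1) ** transpose z)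
    = (\<Sum>j\<in>UNIV. (p v* z) $ j * a $ j)"
proof -
  have "trace (transpose (rowvector p :: complex^'n^1) ** (rowvector a :: complex^'n^1) ** transpose z)
      = (\<Sum>i\<in>UNIV. \<Sum>j\<in>UNIV. p $ i * a $ j * z $ i $ j)"
    by (simp add: trace_def matrix_matrix_mult_def transpose_def rowvector_def)
  also have "\<dots> = (\<Sum>j\<in>UNIV. \<Sum>i\<in>UNIV. p $ i * a $ j * z $ i $ j)" by (rule sum.swap)
  finally show ?thesis
    by (simp add: vector_matrix_mult_def sum_distrib_left mult_ac)
qed

lemma sum_orthonormal_basis_u_bilinear:
  fixes w a b :: "complex^'n"
  assumes B: "orthonormal_basis_u B"
  shows "(\<Sum>Z\<in>B. (\<Sum>j\<in>UNIV. (w v* Z) $ j * a $ j) * (\<Sum>j\<in>UNIV. (w v* Z) $ j * b $ j)) =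
    - ((\<Sum>j\<in>UNIV. w $ j * a $ j) * (\<Sum>j\<in>UNIV. w $ j * b $ j))"
proof -
  \<comment> \<open>A matrix of rank at most one that writes the first factor as a trace; the second
    factor is expanded into entries of \<open>Z\<close> so that the trace identity applies.\<close>
  define M where "M = (\<chi> j i. a $ j * w $ i)"
  have "(\<Sum>j\<in>UNIV. (w v* Z) $ j * a $ j) = trace (M ** Z)" for Z
    by (simp add: M_def trace_def matrix_matrix_mult_def vector_matrix_mult_def
        sum_distrib_left mult_ac)
  moreover have "(\<Sum>j\<in>UNIV. (w v* Z) $ j * b $ j) =
      (\<Sum>l\<in>UNIV. \<Sum>k\<in>UNIV. w $ k * b $ l * Z $ k $ l)" for Z
    by (simp add: vector_matrix_mult_def sum_distrib_left mult_ac)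
  ultimately have "(\<Sum>Z\<in>B. (\<Sum>j\<in>UNIV. (w v* Z) $ j * a $ j) * (\<Sum>j\<in>UNIV. (w v* Z) $ j * b $ j)) =
      (\<Sum>Z\<in>B. \<Sum>l\<in>UNIV. \<Sum>k\<in>UNIV. w $ k * b $ l * (trace (M ** Z) * Z $ k $ l))"
    by (simp add: sum_distrib_left mult_ac)
  also have "\<dots> = (\<Sum>l\<in>UNIV. \<Sum>Z\<in>B. \<Sum>k\<in>UNIV. w $ k * b $ l * (trace (M ** Z) * Z $ k $ l))"
    by (rule sum.swap)
  also have "\<dots> = (\<Sum>l\<in>UNIV. \<Sum>k\<in>UNIV. \<Sum>Z\<in>B. w $ k * b $ l * (trace (M ** Z) * Z $ k $ l))"
    by (intro sum.cong refl sum.swap)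
  also have "\<dots> = (\<Sum>l\<in>UNIV. \<Sum>k\<in>UNIV. w $ k * b $ l * (- M $ k $ l))"
    by (simp only: sum_distrib_left[symmetric] sum_orthonormal_basis_u[OF B])
  \<comment> \<open>Since \<open>M $ k $ l = a $ k * w $ l\<close>, the index \<open>k\<close> pairs
    \<open>w\<close> with \<open>a\<close>, and \<open>l\<close> pairs \<open>w\<close> with
    \<open>b\<close>.\<close>
  also have "\<dots> = - ((\<Sum>j\<in>UNIV. w $ j * a $ j) * (\<Sum>j\<in>UNIV. w $ j * b $ j))"
    by (simp add: M_def sum_product sum_negf mult_ac, subst sum.swap, simp add: mult_ac)
  finally show ?thesis .
qed

theorem theorem5p2:
  fixes p :: "complex^'n"
  assumes "p \<noteq> 0"
  shows "eigenfamily
    {(\<lambda>z\<in>unitary_group.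
        trace (transpose (rowvector p :: complex^'n^1) ** (rowvector a :: complex^'n^1) ** transpose z))
     | a :: complex^'n. True}"
proof -
  \<comment> \<open>The same formula on all matrices, where it is linear; the members of the family
    are its restrictions.\<close>
  define f :: "complex^'n \<Rightarrow> complex^'n^'n \<Rightarrow> complex"
    where "f a z = (\<Sum>j\<in>UNIV. (p v* z) $ j * a $ j)" for a z
  have lin: "linear (f a)" for a
    by (auto intro!: linearI simp: f_def vector_matrix_mult_def algebra_simps sum.distrib
        scaleR_sum_right sum_distrib_left)
  have kappa: "kappa B (restrict (f a) unitary_group) (restrict (f b) unitary_group) z =
      - 1 * f a z * f b z"
    if B: "orthonormal_basis_u B" and z: "z \<in> unitary_group" for B a b z
  proof -
    have "kappa B (restrict (f a) unitary_group) (restrict (f b) unitary_group) z =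
        (\<Sum>Z\<in>B. f a (z ** Z) * f b (z ** Z))"
      unfolding kappa_def
    proof (intro sum.cong refl)
      fix Z assume "Z \<in> B"
      then have "Z \<in> unitary_algebra" using B by (auto simp: orthonormal_basis_u_def)
      then show "left_inv_field Z (restrict (f a) unitary_group) z *
          left_inv_field Z (restrict (f b) unitary_group) z = f a (z ** Z) * f b (z ** Z)"
        using left_inv_field_linear[OF lin] z by simp
    qed
    then show ?thesis
      using sum_orthonormal_basis_u_bilinear[OF B, of "p v* z" a b]
      by (simp add: f_def vector_matrix_mul_assoc)
  qed
  have "eigenfamily {restrict (f a) unitary_group | a. True}"
    unfolding eigenfamily_def
  proof
    show "\<forall>\<phi>\<in>{restrict (f a) unitary_group | a. True}. smooth_on_unitary \<phi>"
      using smooth_on_unitary_linear[OF lin] by auto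
    show "\<exists>l m. \<forall>B. orthonormal_basis_u B \<longrightarrow>
        (\<forall>\<phi>\<in>{restrict (f a) unitary_group | a. True}. \<forall>\<psi>\<in>{restrict (f a) unitary_group | a. True}.
          \<forall>z\<in>unitary_group. tau B \<phi> z = l * \<phi> z \<and> kappa B \<phi> \<psi> z = m * \<phi> z * \<psi> z)"
      \<comment> \<open>The eigenvalues come from \<open>tau_linear\<close> and the contraction
        \<open>kappa\<close>; neither depends on \<open>B\<close>.\<close>
      by (rule exI[of _ "- of_nat CARD('n)"], rule exI[of _ "- 1"])
        (auto simp: tau_linear[OF lin] kappa)
  qed
  then show ?thesis
    by (simp add: trace_rowvectors f_def[abs_def])
qed

end
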